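(* There exist absolute constants $C,c>0$ and a function $p:\mathbb N\to[0,1]$ with $p(n)\to0$ as $n\to\infty$ such that the following holds. Let $n,d$ satisfy $n\ge C\,d\ln(2d)$. Let $\mathbf X\in\mathbb R^{n\times d}$ have i.i.d. $N(0,1)$ entries, and let $\mathbf X'\in\mathbb R^{n\times d}$ be obtained by choosing, independently of $\mathbf X$, indices $\boldsymbol\gamma_1,\dots,\boldsymbol\gamma_n$ i.i.d. uniform in $[n]$ and setting the $i$-th row of $\mathbf X'$ to be the $\boldsymbol\gamma_i$-th row of $\mathbf X$. Then with probability at least $1-p(n)$, the column span of $\mathbf X'$ is $(c\,n,c)$-spread.
   Context: A linear subspace $V\subseteq\mathbb R^n$ is $(m,\rho)$-spread if for every $v\in V$ and every $S\subseteq[n]$ with $|S|\ge n-m$ one has $\|v_S\|\ge\rho\|v\|$, where $v_S$ is the restriction of $v$ to coordinates in $S$. *)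

theory Defs
  imports "HOL-Probability.Probability"
begin

text \<open>Vectors in R^n are functions nat => real; only coordinates i < n matter.
  An n x d matrix is a function nat => nat => real (row index, column index).\<close>

definition col_span :: "nat \<Rightarrow> (nat \<Rightarrow> nat \<Rightarrow> real) \<Rightarrow> (nat \<Rightarrow> real) set" where
  "col_span d A = {v. \<exists>a :: nat \<Rightarrow> real. v = (\<lambda>i. \<Sum>j<d. A i j * a j)}"

definition spread :: "nat \<Rightarrow> real \<Rightarrow> real \<Rightarrow> (nat \<Rightarrow> real) set \<Rightarrow> bool" where
  "spread n m \<rho> V \<longleftrightarrow>
     (\<forall>v\<in>V. \<forall>S. S \<subseteq> {..<n} \<and> real (card S) \<ge> real n - m \<longrightarrow>
        sqrt (\<Sum>i\<in>S. (v i)\<^sup>2) \<ge> \<rho> * sqrt (\<Sum>i<n. (v i)\<^sup>2))"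

definition sample_space :: "nat \<Rightarrow> nat \<Rightarrow> ((nat \<times> nat \<Rightarrow> real) \<times> (nat \<Rightarrow> nat)) measure" where
  "sample_space n d =
     (PiM ({..<n} \<times> {..<d}) (\<lambda>_. std_normal_distribution))
     \<Otimes>\<^sub>M (PiM {..<n} (\<lambda>_. uniform_count_measure {..<n}))"

definition resample :: "(nat \<times> nat \<Rightarrow> real) \<Rightarrow> (nat \<Rightarrow> nat) \<Rightarrow> nat \<Rightarrow> nat \<Rightarrow> real" where
  "resample X \<gamma> = (\<lambda>i j. X (\<gamma> i, j))"

end

theory Submission
  imports Defs "HOL-Real_Asymp.Real_Asymp"
begin

text \<open>
  Condition on the indices \<open>\<gamma>\<close>. With probability tending to 1 they take at least \<open>n / 4\<close> distinct
  values, and no value is taken more than \<open>L = O(ln n)\<close> times; both follow from union bounds over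
  boxes. For such a fixed \<open>\<gamma>\<close>, the quadratic form \<open>\<parallel>X' a\<parallel>\<^sup>2 = \<Sum>\<^sub>k m\<^sub>k (X a)\<^sub>k\<^sup>2\<close> with
  multiplicities \<open>m\<^sub>k \<le> L\<close> is \<open>O(n)\<close> outside an event of probability \<open>exp(- \<Omega>(n / L))\<close>. The
  hypothesis \<open>n \<ge> C d ln(2 d)\<close> gives \<open>n / L \<ge> d / 2\<close>, so this survives a union bound over a net of
  the unit ball of size \<open>exp(O(d))\<close>, and \<open>\<parallel>X' a\<parallel> = O(\<surd>n)\<close> for all unit vectors \<open>a\<close>. Conversely,
  for any fixed \<open>a\<close> the sum of \<open>(X a)\<^sub>k\<^sup>2\<close> over a fixed set \<open>U\<close> of at least \<open>n / 8\<close> rows is below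
  \<open>\<eta> n\<close> with probability at most \<open>8\<^sup>-\<^sup>n\<close>, which beats the union over all \<open>U\<close> and over a fine net.
  Deleting \<open>n / 8\<close> rows of \<open>X'\<close> leaves at least \<open>n / 8\<close> distinct rows of \<open>X\<close>, so the two bounds
  together give the spread property.
\<close>

section \<open>Nets of the unit ball\<close>

lemma sum_half_power_abs:
  "(\<Sum>z\<in>{-int M..int M}. (1/2::real) ^ nat \<bar>z\<bar>) = 3 - 2 * (1/2) ^ M"
proof (induction M)
  case (Suc M)
  have "{-int (Suc M)..int (Suc M)} = insert (int (Suc M)) (insert (- int (Suc M)) {-int M..int M})"
    by auto
  then show ?case
    using Suc.IH by (simp add: nat_add_distrib)
qed simp

text \<open>Taking \<open>m = R * d\<close> makes this bound exponential in \<open>d\<close>, which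
  is the size allowed for a net. Extensional functions keep the set of integer points
  finite.\<close>

lemma card_l1_ball_le:
  fixes d m :: nat
  defines "Z \<equiv> {z \<in> {..<d} \<rightarrow>\<^sub>E (UNIV :: int set). (\<Sum>j<d. nat \<bar>z j\<bar>) \<le> m}"
  shows "finite Z" "real (card Z) \<le> 2 ^ m * 3 ^ d"
proof -
  let ?B = "{..<d} \<rightarrow>\<^sub>E {-int m..int m}"
  let ?w = "\<lambda>z. (1/2::real) ^ nat \<bar>z\<bar>"
  have sub: "Z \<subseteq> ?B"
  proof
    fix z assume z: "z \<in> Z"
    have "nat \<bar>z j\<bar> \<le> m" if "j < d" for j
    proof -
      have "nat \<bar>z j\<bar> \<le> (\<Sum>j<d. nat \<bar>z j\<bar>)"
        using that by (intro member_le_sum) auto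
      with z show ?thesis by (simp add: Z_def)
    qed
    then have "z j \<in> {-int m..int m}" if "j < d" for j
      using that by fastforce
    with z show "z \<in> ?B"
      by (auto simp: Z_def PiE_iff)
  qed
  have fin: "finite ?B" by (intro finite_PiE) auto
  with sub show "finite Z" by (rule finite_subset)
  \<comment> \<open>Weight \<open>z\<close> by \<open>2\<^sup>m\<^sup>-\<^sup>|\<^sup>z\<^sup>|\<close>, which is at least 1 on \<open>Z\<close> and factorizes over the coordinates.\<close>
  have "real (card Z) = (\<Sum>z\<in>Z. 1)" by simp
  also have "\<dots> \<le> (\<Sum>z\<in>Z. 2 ^ m * (\<Prod>j<d. ?w (z j)))"
  proof (intro sum_mono)
    fix z assume "z \<in> Z"
    then have "(1/2::real) ^ m \<le> (1/2) ^ (\<Sum>j<d. nat \<bar>z j\<bar>)"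
      by (intro power_decreasing) (auto simp: Z_def)
    also have "\<dots> = (\<Prod>j<d. ?w (z j))" by (simp add: power_sum)
    finally show "1 \<le> 2 ^ m * (\<Prod>j<d. ?w (z j))"
      by (simp add: field_simps)
  qed
  also have "\<dots> \<le> (\<Sum>z\<in>?B. 2 ^ m * (\<Prod>j<d. ?w (z j)))"
    using sub fin by (intro sum_mono2 mult_nonneg_nonneg prod_nonneg) auto
  also have "\<dots> = 2 ^ m * (\<Prod>j<d. \<Sum>z\<in>{-int m..int m}. ?w z)"
    by (subst prod_sum_PiE) (auto simp: sum_distrib_left)
  also have "\<dots> = 2 ^ m * (3 - 2 * (1/2) ^ m) ^ d"
    by (simp only: sum_half_power_abs prod_constant card_lessThan)
  also have "\<dots> \<le> 2 ^ m * 3 ^ d"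
    using power_decreasing[of 0 m "1/2::real"]
    by (intro mult_left_mono power_mono) auto
  finally show "real (card Z) \<le> 2 ^ m * 3 ^ d" .
qed

text \<open>The net consists of points of the lattice of mesh \<open>h = 1 / sqrt (R * d)\<close>.
  Rounding costs at most \<open>h\<close> per coordinate, hence
  \<open>h * sqrt d = 1 / sqrt R\<close> in norm. Only lattice points \<open>h * z\<close> with
  small l1 norm of \<open>z\<close> are needed, so the number of lattice points is controlled by
  \<open>card_l1_ball_le\<close>.\<close>

lemma unit_ball_net:
  fixes R d :: nat
  assumes "R > 0"
  obtains N :: "(nat \<Rightarrow> real) set" where
    "finite N" "real (card N) \<le> (3 * 2 ^ R) ^ d"
    "\<And>a. a \<in> N \<Longrightarrow> L2_set a {..<d} \<le> 1"
    "\<And>a. L2_set a {..<d} \<le> 1 \<Longrightarrow>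
       \<exists>b\<in>N. L2_set (\<lambda>j. a j - b j) {..<d} \<le> 1 / sqrt (real R)"
proof (cases "d = 0")
  case True
  show ?thesis by (rule that[of "{\<lambda>_. 0}"]) (auto simp: True)
next
  case False
  define h where "h = 1 / sqrt (real (R * d))"
  have h: "h > 0" and h2: "h\<^sup>2 * real (R * d) = 1"
    using assms False by (simp_all add: h_def power_divide)
  define Z where "Z = {z \<in> {..<d} \<rightarrow>\<^sub>E (UNIV :: int set). (\<Sum>j<d. nat \<bar>z j\<bar>) \<le> R * d}"
  have Z: "finite Z" "real (card Z) \<le> 2 ^ (R * d) * 3 ^ d"
    unfolding Z_def by (rule card_l1_ball_le)+
  let ?f = "\<lambda>(z :: nat \<Rightarrow> int) j. h * of_int (z j)"
  define N where "N = {a \<in> ?f ` Z. L2_set a {..<d} \<le> 1}"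
  show ?thesis
  proof (rule that[of N])
    show "finite N" using Z by (auto simp: N_def)
    have "card N \<le> card (?f ` Z)"
      using Z by (intro card_mono) (auto simp: N_def)
    also have "\<dots> \<le> card Z" using Z by (intro card_image_le)
    finally have "real (card N) \<le> 2 ^ (R * d) * 3 ^ d" using Z by linarith
    then show "real (card N) \<le> (3 * 2 ^ R) ^ d"
      by (simp add: power_mult power_mult_distrib mult_ac)
    show "L2_set a {..<d} \<le> 1" if "a \<in> N" for a
      using that by (simp add: N_def)
    fix a :: "nat \<Rightarrow> real" assume a: "L2_set a {..<d} \<le> 1"
    \<comment> \<open>Rounding towards 0 keeps the rounded vector in the unit ball.\<close>
    define z where "z j = (if j < d then (if a j \<ge> 0 then \<lfloor>a j / h\<rfloor> else - \<lfloor>- a j / h\<rfloor>) else undefined)" for j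
    have z: "\<bar>h * z j\<bar> \<le> \<bar>a j\<bar>" "\<bar>a j - h * z j\<bar> \<le> h" if "j < d" for j
    proof -
      have "\<bar>real_of_int (z j)\<bar> \<le> \<bar>a j\<bar> / h \<and> \<bar>a j / h - real_of_int (z j)\<bar> \<le> 1"
      proof (cases "a j \<ge> 0")
        case True
        then have "0 \<le> \<lfloor>a j / h\<rfloor>" using h by simp
        then show ?thesis using True that unfolding z_def by (simp; linarith)
      next
        case False
        then have "0 \<le> \<lfloor>- (a j / h)\<rfloor>" using h by (simp add: divide_nonpos_pos)
        then show ?thesis using False that unfolding z_def by (simp; linarith)
      qed
      moreover have "a j - h * z j = h * (a j / h - z j)"
        using h by (simp add: right_diff_distrib)
      then have "\<bar>a j - h * z j\<bar> = h * \<bar>a j / h - z j\<bar>"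
        using h by (simp add: abs_mult)
      ultimately show "\<bar>h * z j\<bar> \<le> \<bar>a j\<bar>" "\<bar>a j - h * z j\<bar> \<le> h"
        using h by (simp_all add: abs_mult pos_le_divide_eq mult.commute mult_left_le)
    qed
    have le: "L2_set (?f z) {..<d} \<le> L2_set a {..<d}"
      unfolding L2_set_def using z by (intro real_sqrt_le_mono sum_mono) (auto simp: abs_le_square_iff)
    \<comment> \<open>For integers the absolute value is at most the square, so the l2 bound on
      \<open>h * z\<close> gives the l1 bound that defines \<open>Z\<close>.\<close>
    have "real (\<Sum>j<d. nat \<bar>z j\<bar>) \<le> (\<Sum>j<d. (real_of_int (z j))\<^sup>2)"
      unfolding of_nat_sum
    proof (intro sum_mono)
      fix j
      have "\<bar>z j\<bar> \<le> (z j)\<^sup>2"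
        using mult_left_mono[of 1 "\<bar>z j\<bar>" "\<bar>z j\<bar>"]
        by (cases "z j = 0") (auto simp: power2_eq_square)
      then show "real (nat \<bar>z j\<bar>) \<le> (real_of_int (z j))\<^sup>2"
        by (metis of_int_le_iff of_int_power of_nat_nat abs_ge_zero)
    qed
    also have "\<dots> = (L2_set (?f z) {..<d})\<^sup>2 * real (R * d)"
    proof -
      have "(L2_set (?f z) {..<d})\<^sup>2 = h\<^sup>2 * (\<Sum>j<d. (real_of_int (z j))\<^sup>2)"
        by (simp add: L2_set_def sum_nonneg power_mult_distrib sum_distrib_left)
      then show ?thesis using h2 by (metis mult.commute mult.left_commute mult_1)
    qed
    also have "\<dots> \<le> 1\<^sup>2 * real (R * d)"
      using le a by (intro mult_right_mono power_mono) auto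
    finally have "(\<Sum>j<d. nat \<bar>z j\<bar>) \<le> R * d" by (simp only: power_one mult_1 of_nat_le_iff)
    moreover have "z \<in> {..<d} \<rightarrow>\<^sub>E UNIV" by (auto simp: z_def PiE_iff extensional_def)
    ultimately have "z \<in> Z" by (simp add: Z_def)
    then have "?f z \<in> N" using le a by (auto simp: N_def)
    moreover have "L2_set (\<lambda>j. a j - ?f z j) {..<d} \<le> L2_set (\<lambda>_. h) {..<d}"
      unfolding L2_set_def using z h by (intro real_sqrt_le_mono sum_mono) (auto simp flip: abs_le_square_iff)
    moreover have "L2_set (\<lambda>_. h) {..<d} = 1 / sqrt (real R)"
      using h False by (simp add: L2_set_constant h_def real_sqrt_mult)
    ultimately show "\<exists>b\<in>N. L2_set (\<lambda>j. a j - b j) {..<d} \<le> 1 / sqrt (real R)"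
      by auto
  qed
qed

section \<open>Exponential moments of Gaussian quadratic forms\<close>

text \<open>Multiplying a centred normal density by \<open>exp (t * y^2)\<close> gives, up to the
  factor \<open>1 / sqrt q\<close>, the centred normal density of variance
  \<open>\<sigma>^2 / q\<close>, where \<open>q = 1 - 2 * t * \<sigma>^2\<close>.\<close>

lemma nn_integral_exp_square_normal:
  fixes t \<sigma> :: real
  assumes "\<sigma> > 0" "2 * t * \<sigma>\<^sup>2 < 1"
  shows "(\<integral>\<^sup>+y. ennreal (normal_density 0 \<sigma> y) * ennreal (exp (t * y\<^sup>2)) \<partial>lborel) =
           ennreal (1 / sqrt (1 - 2 * t * \<sigma>\<^sup>2))"
proof -
  define q where "q = 1 - 2 * t * \<sigma>\<^sup>2"
  define \<tau> where "\<tau> = \<sigma> / sqrt q"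
  have q: "q > 0" using assms by (simp add: q_def)
  have \<tau>: "\<tau> > 0" "\<tau>\<^sup>2 = \<sigma>\<^sup>2 / q" using assms q by (simp_all add: \<tau>_def power_divide)
  have "normal_density 0 \<sigma> y * exp (t * y\<^sup>2) = (1 / sqrt q) * normal_density 0 \<tau> y" for y
  proof -
    have "- y\<^sup>2 / (2 * \<sigma>\<^sup>2) + t * y\<^sup>2 = - y\<^sup>2 / (2 * \<tau>\<^sup>2)"
      using assms q unfolding \<tau> by (simp add: q_def field_simps)
    moreover have "1 / sqrt (2 * pi * \<sigma>\<^sup>2) = (1 / sqrt q) * (1 / sqrt (2 * pi * \<tau>\<^sup>2))"
      using assms q unfolding \<tau> by (simp add: real_sqrt_mult real_sqrt_divide)
    ultimately show ?thesis
      by (simp add: normal_density_def flip: exp_add)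
  qed
  then have "(\<integral>\<^sup>+y. ennreal (normal_density 0 \<sigma> y) * ennreal (exp (t * y\<^sup>2)) \<partial>lborel) =
      (\<integral>\<^sup>+y. ennreal (1 / sqrt q) * ennreal (normal_density 0 \<tau> y) \<partial>lborel)"
    using q by (simp add: ennreal_mult[symmetric])
  also have "\<dots> = ennreal (1 / sqrt q) * (\<integral>\<^sup>+y. ennreal (normal_density 0 \<tau> y) \<partial>lborel)"
    by (rule nn_integral_cmult) simp
  also have "(\<integral>\<^sup>+y. ennreal (normal_density 0 \<tau> y) \<partial>lborel) = 1"
    using \<tau>(1) prob_space.emeasure_space_1[OF prob_space_normal_density[of \<tau> 0]]
    by (simp add: emeasure_density)
  finally show ?thesis by (simp add: q_def)
qed

section \<open>Gaussian matrices applied to a fixed vector\<close>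

abbreviation gaussian_matrix :: "nat \<Rightarrow> nat \<Rightarrow> (nat \<times> nat \<Rightarrow> real) measure" where
  "gaussian_matrix n d \<equiv> PiM ({..<n} \<times> {..<d}) (\<lambda>_. std_normal_distribution)"

text \<open>A coordinate of the matrix-vector product; \<open>mv d X a (\<gamma> i)\<close> is the
  \<open>i\<close>-th coordinate after resampling.\<close>

definition mv :: "nat \<Rightarrow> (nat \<times> nat \<Rightarrow> real) \<Rightarrow> (nat \<Rightarrow> real) \<Rightarrow> nat \<Rightarrow> real" where
  "mv d X a k = (\<Sum>j<d. X (k, j) * a j)"

lemma prob_space_std_normal: "prob_space std_normal_distribution"
  by (intro prob_space_normal_density) simp

lemma prob_space_gaussian_matrix: "prob_space (gaussian_matrix n d)"
  by (intro prob_space_PiM prob_space_std_normal)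

text \<open>The joint law of the coordinates is the product of their marginals by construction. That
  characterization of independence needs a nonempty index set, hence the case split.\<close>

lemma indep_vars_PiM_components:
  assumes "\<And>i. i \<in> I \<Longrightarrow> prob_space (M i)"
  shows "prob_space.indep_vars (PiM I M) M (\<lambda>i \<omega>. \<omega> i) I"
proof -
  interpret prob_space "PiM I M" using assms by (rule prob_space_PiM)
  show ?thesis
  proof (cases "I = {}")
    case True
    then show ?thesis unfolding indep_vars_def indep_sets_def by auto
  next
    case False
    have "distr (PiM I M) (PiM I M) (\<lambda>\<omega>. restrict \<omega> I) = distr (PiM I M) (PiM I M) (\<lambda>\<omega>. \<omega>)"
      by (intro distr_cong) (auto simp: space_PiM)
    also have "\<dots> = PiM I M" by (rule distr_id)
    also have "\<dots> = PiM I (\<lambda>i. distr (PiM I M) (M i) (\<lambda>\<omega>. \<omega> i))"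
      using assms by (intro PiM_cong) (auto simp: distr_PiM_component)
    finally show ?thesis
      using False by (subst indep_vars_iff_distr_eq_PiM') auto
  qed
qed

lemma measurable_entry [measurable]:
  assumes "k < n" "j < d"
  shows "(\<lambda>X. X (k, j)) \<in> borel_measurable (gaussian_matrix n d)"
proof -
  have "(\<lambda>X. X (k, j)) \<in> measurable (gaussian_matrix n d) std_normal_distribution"
    using assms by (intro measurable_component_singleton) auto
  then show ?thesis by simp
qed

lemma measurable_mv [measurable]:
  assumes "k < n"
  shows "(\<lambda>X. mv d X a k) \<in> borel_measurable (gaussian_matrix n d)"
  unfolding mv_def using assms by measurable

lemma indep_vars_entries:
  "prob_space.indep_vars (gaussian_matrix n d) (\<lambda>_. borel) (\<lambda>i X. X i) ({..<n} \<times> {..<d})"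
proof -
  interpret prob_space "gaussian_matrix n d" by (rule prob_space_gaussian_matrix)
  have "indep_vars (\<lambda>_. std_normal_distribution) (\<lambda>i X. X i) ({..<n} \<times> {..<d})"
    by (intro indep_vars_PiM_components prob_space_std_normal)
  from indep_vars_compose2[OF this, of "\<lambda>_ x. x" "\<lambda>_. borel"] show ?thesis by simp
qed

text \<open>Distinct rows use disjoint blocks of independent entries.\<close>

lemma indep_vars_mv:
  "prob_space.indep_vars (gaussian_matrix n d) (\<lambda>_. borel) (\<lambda>k X. mv d X a k) {..<n}"
proof -
  interpret prob_space "gaussian_matrix n d" by (rule prob_space_gaussian_matrix)
  have "indep_vars (\<lambda>k. PiM ({k} \<times> {..<d}) (\<lambda>_. borel))
      (\<lambda>k X. restrict (\<lambda>i. X i) ({k} \<times> {..<d})) {..<n}"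
    by (rule indep_vars_restrict[OF indep_vars_entries]) (auto simp: disjoint_family_on_def)
  then have "indep_vars (\<lambda>_. borel)
      (\<lambda>k X. \<Sum>j<d. restrict (\<lambda>i. X i) ({k} \<times> {..<d}) (k, j) * a j) {..<n}"
    by (rule indep_vars_compose2) measurable
  then show ?thesis
    by (rule indep_vars_cong[THEN iffD1, rotated -1]) (auto simp: mv_def fun_eq_iff)
qed

lemma distributed_mv:
  assumes "k < n" "L2_set a {..<d} > 0"
  shows "distributed (gaussian_matrix n d) lborel (\<lambda>X. mv d X a k)
           (normal_density 0 (L2_set a {..<d}))"
proof -
  interpret prob_space "gaussian_matrix n d" by (rule prob_space_gaussian_matrix)
  \<comment> \<open>\<open>sum_indep_normal\<close> wants nondegenerate summands over a nonempty
    set: zero coefficients are dropped, and the positive norm of \<open>a\<close> keeps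
    \<open>J\<close> nonempty.\<close>
  define J where "J = {j. j < d \<and> a j \<noteq> 0}"
  have fJ: "finite J" by (simp add: J_def)
  have s: "L2_set a {..<d} = sqrt (\<Sum>j\<in>J. (\<bar>a j\<bar> * 1)\<^sup>2)"
    unfolding L2_set_def J_def by (intro arg_cong[of _ _ sqrt] sum.mono_neutral_cong_right) auto
  have J: "J \<noteq> {}" using assms(2) unfolding s by auto
  have "distributed (gaussian_matrix n d) lborel (\<lambda>X. \<Sum>i\<in>{k} \<times> J. 0 + a (snd i) * X i)
     (normal_density (\<Sum>i\<in>{k} \<times> J. 0 + a (snd i) * 0) (sqrt (\<Sum>i\<in>{k} \<times> J. (\<bar>a (snd i)\<bar> * 1)\<^sup>2)))"
  proof (rule sum_indep_normal)
    show "finite ({k} \<times> J)" "{k} \<times> J \<noteq> {}" using fJ J by auto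
    have "indep_vars (\<lambda>_. borel) (\<lambda>i X. X i) ({k} \<times> J)"
      using assms by (intro indep_vars_subset[OF indep_vars_entries]) (auto simp: J_def)
    then show "indep_vars (\<lambda>_. borel) (\<lambda>i X. 0 + a (snd i) * X i) ({k} \<times> J)"
      by (rule indep_vars_compose2) measurable
    fix i assume i: "i \<in> {k} \<times> J"
    then show "0 < \<bar>a (snd i)\<bar> * 1"
      by (auto simp: J_def)
    have "distr (gaussian_matrix n d) std_normal_distribution (\<lambda>X. X i) = std_normal_distribution"
      using i assms by (intro distr_PiM_component prob_space_std_normal) (auto simp: J_def)
    also have "distr (gaussian_matrix n d) std_normal_distribution (\<lambda>X. X i) =
               distr (gaussian_matrix n d) lborel (\<lambda>X. X i)"
      by (intro distr_cong) auto
    finally have "distributed (gaussian_matrix n d) lborel (\<lambda>X. X i) std_normal_density"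
      using i assms measurable_entry by (auto simp: distributed_def J_def)
    then show "distributed (gaussian_matrix n d) lborel (\<lambda>X. 0 + a (snd i) * X i)
        (normal_density (0 + a (snd i) * 0) (\<bar>a (snd i)\<bar> * 1))"
      using i by (intro normal_density_affine) (auto simp: J_def)
  qed
  also have "(\<lambda>X. \<Sum>i\<in>{k} \<times> J. 0 + a (snd i) * X i) = (\<lambda>X. mv d X a k)"
  proof
    fix X :: "nat \<times> nat \<Rightarrow> real"
    have "(\<Sum>i\<in>{k} \<times> J. 0 + a (snd i) * X i) = (\<Sum>j\<in>J. a j * X (k, j))"
      using sum.cartesian_product[of "\<lambda>x y. a y * X (x, y)" J "{k}"] by (simp add: case_prod_unfold)
    also have "\<dots> = mv d X a k"
      unfolding mv_def J_def by (intro sum.mono_neutral_cong_left) auto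
    finally show "(\<Sum>i\<in>{k} \<times> J. 0 + a (snd i) * X i) = mv d X a k" .
  qed
  also have "(\<Sum>i\<in>{k} \<times> J. (\<bar>a (snd i)\<bar> * 1)\<^sup>2) = (\<Sum>j\<in>J. (\<bar>a j\<bar> * 1)\<^sup>2)"
    using sum.cartesian_product[of "\<lambda>x y. (\<bar>a y\<bar> * 1)\<^sup>2" J "{k}"] by (simp add: case_prod_unfold)
  finally show ?thesis by (simp add: s mv_def)
qed

lemma nn_integral_exp_square_mv:
  assumes "k < n" "2 * t * (L2_set a {..<d})\<^sup>2 < 1"
  shows "(\<integral>\<^sup>+X. ennreal (exp (t * (mv d X a k)\<^sup>2)) \<partial>gaussian_matrix n d) =
           ennreal (1 / sqrt (1 - 2 * t * (L2_set a {..<d})\<^sup>2))"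
proof (cases "L2_set a {..<d} = 0")
  case True
  then have "mv d X a k = 0" for X
    by (simp add: mv_def L2_set_eq_0_iff)
  then show ?thesis
    using True prob_space.emeasure_space_1[OF prob_space_gaussian_matrix] by simp
next
  case False
  then have pos: "L2_set a {..<d} > 0" using L2_set_nonneg[of a "{..<d}"] by linarith
  show ?thesis
    using distributed_nn_integral[OF distributed_mv[OF assms(1) pos], of "\<lambda>y. ennreal (exp (t * y\<^sup>2))"]
      nn_integral_exp_square_normal[OF pos assms(2)] by simp
qed

text \<open>Independence of the rows factorizes the moment. The weights may have either sign:
  positive ones serve the upper tail, negative ones the lower tail.\<close>

lemma nn_integral_exp_weighted_squares:
  assumes "\<And>k. k < n \<Longrightarrow> 2 * u k * (L2_set a {..<d})\<^sup>2 < 1"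
  shows "(\<integral>\<^sup>+X. ennreal (exp (\<Sum>k<n. u k * (mv d X a k)\<^sup>2)) \<partial>gaussian_matrix n d) =
           ennreal (\<Prod>k<n. 1 / sqrt (1 - 2 * u k * (L2_set a {..<d})\<^sup>2))"
proof -
  interpret prob_space "gaussian_matrix n d" by (rule prob_space_gaussian_matrix)
  have "indep_vars (\<lambda>_. borel) (\<lambda>k X. ennreal (exp (u k * (mv d X a k)\<^sup>2))) {..<n}"
    by (rule indep_vars_compose2[OF indep_vars_mv]) measurable
  then have "(\<integral>\<^sup>+X. (\<Prod>k<n. ennreal (exp (u k * (mv d X a k)\<^sup>2))) \<partial>gaussian_matrix n d) =
      (\<Prod>k<n. \<integral>\<^sup>+X. ennreal (exp (u k * (mv d X a k)\<^sup>2)) \<partial>gaussian_matrix n d)"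
    by (intro indep_vars_nn_integral) auto
  also have "\<dots> = (\<Prod>k<n. ennreal (1 / sqrt (1 - 2 * u k * (L2_set a {..<d})\<^sup>2)))"
    using assms by (intro prod.cong nn_integral_exp_square_mv) auto
  finally show ?thesis
    using assms by (subst (asm) prod_ennreal; simp add: exp_sum prod_ennreal less_imp_le)
qed

text \<open>On this range \<open>1 / (1 - x) \<le> 1 + 2 * x \<le> exp (2 * x)\<close>; then take
  square roots.\<close>

lemma inverse_sqrt_le_exp:
  fixes x :: real
  assumes "0 \<le> x" "x \<le> 1/2"
  shows "1 / sqrt (1 - x) \<le> exp x"
proof -
  have "1 \<le> (1 + 2 * x) * (1 - x)"
    using mult_left_mono[of x "1/2" x] assms by (simp add: algebra_simps)
  then have "1 / (1 - x) \<le> 1 + 2 * x"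
    using assms by (simp add: pos_divide_le_eq)
  also have "\<dots> \<le> exp (2 * x)" by (rule exp_ge_add_one_self)
  also have "\<dots> = (exp x)\<^sup>2" by (simp add: power2_eq_square flip: exp_add)
  finally have "sqrt (1 / (1 - x)) \<le> sqrt ((exp x)\<^sup>2)" by (rule real_sqrt_le_mono)
  then show ?thesis by (simp add: real_sqrt_divide)
qed

section \<open>Chernoff bounds for the two tails\<close>

lemma sum_fibers:
  fixes f :: "nat \<Rightarrow> real"
  assumes "\<And>i. i < n \<Longrightarrow> \<gamma> i < n"
  shows "(\<Sum>i<n. f (\<gamma> i)) = (\<Sum>k<n. real (card {i. i < n \<and> \<gamma> i = k}) * f k)"
proof -
  have "(\<Sum>i<n. f (\<gamma> i)) = (\<Sum>k<n. \<Sum>i\<in>{i. i \<in> {..<n} \<and> \<gamma> i = k}. f (\<gamma> i))"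
    using assms by (intro sum.group[symmetric]) auto
  also have "\<dots> = (\<Sum>k<n. real (card {i. i < n \<and> \<gamma> i = k}) * f k)"
    by (intro sum.cong) auto
  finally show ?thesis .
qed

text \<open>Chernoff with parameter \<open>s = 1 / (4 * L)\<close>: the weights
  \<open>s * m k\<close> stay at most 1/4, so the moments are finite. The multiplicities sum to
  \<open>n\<close>, so the product of moments is at most \<open>exp (2 * s * n)\<close>, and
  \<open>exp (- 36 * s * n)\<close> remains after the threshold \<open>38 * n\<close>.\<close>

lemma emeasure_upper_tail:
  fixes L :: nat
  assumes \<gamma>: "\<And>i. i < n \<Longrightarrow> \<gamma> i < n"
    and L: "L > 0" "\<And>k. k < n \<Longrightarrow> card {i. i < n \<and> \<gamma> i = k} \<le> L"
    and a: "L2_set a {..<d} \<le> 1"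
  shows "emeasure (gaussian_matrix n d)
           {X \<in> space (gaussian_matrix n d). (\<Sum>i<n. (mv d X a (\<gamma> i))\<^sup>2) \<ge> 38 * real n}
         \<le> ennreal (exp (- 9 * real n / real L))"
proof -
  let ?G = "gaussian_matrix n d"
  define m where "m k = real (card {i. i < n \<and> \<gamma> i = k})" for k
  define s where "s = 1 / (4 * real L)"
  define \<sigma> where "\<sigma> = L2_set a {..<d}"
  have s: "s > 0" using L by (simp add: s_def)
  have \<sigma>: "0 \<le> \<sigma>\<^sup>2" "\<sigma>\<^sup>2 \<le> 1" using a by (auto simp: \<sigma>_def power_le_one)
  have sm: "0 \<le> s * m k" "s * m k \<le> 1/4" if "k < n" for k
    using L that by (auto simp: s_def m_def)
  have sm\<sigma>: "2 * (s * m k) * \<sigma>\<^sup>2 \<le> 2 * (s * m k)" if "k < n" for k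
    using mult_left_mono[OF \<sigma>(2), of "2 * (s * m k)"] sm[OF that] by simp
  have eq: "(\<Sum>i<n. (mv d X a (\<gamma> i))\<^sup>2) = (\<Sum>k<n. m k * (mv d X a k)\<^sup>2)" for X
    unfolding m_def by (rule sum_fibers) (rule \<gamma>)
  have m: "(\<Sum>k<n. m k) = real n"
    using sum_fibers[OF \<gamma>, where f = "\<lambda>_. 1"] by (simp add: m_def)
  have "emeasure ?G {X \<in> space ?G. (\<Sum>k<n. m k * (mv d X a k)\<^sup>2) \<ge> 38 * real n} \<le>
      ennreal (exp (- s * (38 * real n))) *
        (\<integral>\<^sup>+X. ennreal (exp (s * (\<Sum>k<n. m k * (mv d X a k)\<^sup>2))) * indicator (space ?G) X \<partial>?G)"
    by (intro Chernoff_ineq_nn_integral_ge s) measurable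
  also have "(\<integral>\<^sup>+X. ennreal (exp (s * (\<Sum>k<n. m k * (mv d X a k)\<^sup>2))) * indicator (space ?G) X \<partial>?G) =
      (\<integral>\<^sup>+X. ennreal (exp (\<Sum>k<n. (s * m k) * (mv d X a k)\<^sup>2)) \<partial>?G)"
    by (intro nn_integral_cong) (simp add: sum_distrib_left mult.assoc)
  also have "\<dots> = ennreal (\<Prod>k<n. 1 / sqrt (1 - 2 * (s * m k) * \<sigma>\<^sup>2))"
    unfolding \<sigma>_def
  proof (rule nn_integral_exp_weighted_squares)
    fix k assume "k < n"
    then show "2 * (s * m k) * (L2_set a {..<d})\<^sup>2 < 1"
      using sm[of k] sm\<sigma>[of k] unfolding \<sigma>_def by linarith
  qed
  also have "(\<Prod>k<n. 1 / sqrt (1 - 2 * (s * m k) * \<sigma>\<^sup>2)) \<le> (\<Prod>k<n. exp (2 * (s * m k)))"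
  proof (rule prod_mono)
    fix k assume "k \<in> {..<n}"
    then have k: "k < n" by simp
    have "0 \<le> 2 * (s * m k) * \<sigma>\<^sup>2" using sm[OF k] \<sigma> by simp
    then have "1 / sqrt (1 - 2 * (s * m k) * \<sigma>\<^sup>2) \<le> exp (2 * (s * m k) * \<sigma>\<^sup>2)"
      using sm[OF k] sm\<sigma>[OF k] by (intro inverse_sqrt_le_exp) linarith+
    also have "\<dots> \<le> exp (2 * (s * m k))" using sm\<sigma>[OF k] by simp
    finally show "0 \<le> 1 / sqrt (1 - 2 * (s * m k) * \<sigma>\<^sup>2) \<and>
        1 / sqrt (1 - 2 * (s * m k) * \<sigma>\<^sup>2) \<le> exp (2 * (s * m k))"
      using sm[OF k] sm\<sigma>[OF k] by (simp add: less_imp_le)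
  qed
  also have "(\<Prod>k<n. exp (2 * (s * m k))) = exp (2 * s * real n)"
    by (simp add: exp_sum[symmetric] sum_distrib_left[symmetric] m mult.assoc)
  also have "ennreal (exp (- s * (38 * real n))) * ennreal (exp (2 * s * real n)) =
      ennreal (exp (- 9 * real n / real L))"
    using L by (simp add: ennreal_mult[symmetric] exp_add[symmetric] s_def field_simps)
  \<comment> \<open>The chain estimates factors inside a product, so \<open>bound\<close> still
    carries monotonicity side conditions, discharged in the last step.\<close>
  also note bound = calculation
  show ?thesis
    unfolding eq by (rule bound) (intro mult_left_mono ennreal_leI; simp)+
qed

text \<open>Chernoff with parameter \<open>- s\<close> on the rows in \<open>U\<close>. Since
  \<open>\<sigma>^2 \<ge> 1/4\<close> and \<open>s \<ge> 2^81\<close>, each such row contributes a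
  factor at most \<open>2^-40\<close>; with \<open>8 * card U \<ge> n\<close> this gives
  \<open>32^-n\<close>. The prefactor \<open>exp (s * \<eta> * n) = exp n\<close> is at most
  \<open>4^n\<close>.\<close>

lemma emeasure_lower_tail:
  fixes \<eta> s :: real
  assumes U: "U \<subseteq> {..<n}" "n \<le> 8 * card U"
    and s: "s * \<eta> = 1" "s \<ge> 2 ^ 81"
    and a: "L2_set a {..<d} \<ge> 1/2"
  shows "emeasure (gaussian_matrix n d)
           {X \<in> space (gaussian_matrix n d). (\<Sum>k\<in>U. (mv d X a k)\<^sup>2) \<le> \<eta> * real n}
         \<le> ennreal ((1/8) ^ n)"
proof -
  let ?G = "gaussian_matrix n d"
  define \<sigma> where "\<sigma> = L2_set a {..<d}"
  have \<sigma>: "\<sigma>\<^sup>2 \<ge> 1/4"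
    using power_mono[OF a, of 2] by (simp add: \<sigma>_def power_divide)
  have s0: "s > 0" using s(2) by (rule less_le_trans[rotated]) simp
  define u where "u k = (if k \<in> U then - s else 0)" for k
  have "emeasure ?G {X \<in> space ?G. (\<Sum>k\<in>U. (mv d X a k)\<^sup>2) \<le> \<eta> * real n} \<le>
      ennreal (exp (s * (\<eta> * real n))) *
        (\<integral>\<^sup>+X. ennreal (exp (- s * (\<Sum>k\<in>U. (mv d X a k)\<^sup>2))) * indicator (space ?G) X \<partial>?G)"
  proof (intro Chernoff_ineq_nn_integral_le s0)
    have "(\<lambda>X. mv d X a k) \<in> borel_measurable ?G" if "k \<in> U" for k
      using that U by (intro measurable_mv) auto
    then show "(\<lambda>X. \<Sum>k\<in>U. (mv d X a k)\<^sup>2) \<in> borel_measurable ?G" by measurable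
  qed simp
  also have "(\<integral>\<^sup>+X. ennreal (exp (- s * (\<Sum>k\<in>U. (mv d X a k)\<^sup>2))) * indicator (space ?G) X \<partial>?G) =
      (\<integral>\<^sup>+X. ennreal (exp (\<Sum>k<n. u k * (mv d X a k)\<^sup>2)) \<partial>?G)"
  proof (rule nn_integral_cong)
    fix X assume "X \<in> space ?G"
    moreover have "- s * (\<Sum>k\<in>U. (mv d X a k)\<^sup>2) = (\<Sum>k<n. u k * (mv d X a k)\<^sup>2)"
      unfolding sum_distrib_left u_def using U by (intro sum.mono_neutral_cong_left) auto
    ultimately show "ennreal (exp (- s * (\<Sum>k\<in>U. (mv d X a k)\<^sup>2))) * indicator (space ?G) X =
        ennreal (exp (\<Sum>k<n. u k * (mv d X a k)\<^sup>2))" by simp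
  qed
  also have "\<dots> = ennreal (\<Prod>k<n. 1 / sqrt (1 - 2 * u k * \<sigma>\<^sup>2))"
    unfolding \<sigma>_def
  proof (rule nn_integral_exp_weighted_squares)
    fix k
    have "0 \<le> 2 * s * (L2_set a {..<d})\<^sup>2" using s0 by simp
    then show "2 * u k * (L2_set a {..<d})\<^sup>2 < 1" by (simp add: u_def)
  qed
  also have "(\<Prod>k<n. 1 / sqrt (1 - 2 * u k * \<sigma>\<^sup>2)) = (\<Prod>k\<in>U. 1 / sqrt (1 + 2 * s * \<sigma>\<^sup>2))"
    unfolding u_def using U by (intro prod.mono_neutral_cong_right) auto
  also have "\<dots> = (1 / sqrt (1 + 2 * s * \<sigma>\<^sup>2)) ^ card U" by simp
  also have "\<dots> \<le> (1 / 2 ^ 40) ^ card U"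
  proof (intro power_mono)
    have "(2 ^ 81 :: real) * (1/4) \<le> s * \<sigma>\<^sup>2"
      using s s0 \<sigma> by (intro mult_mono) auto
    then have "(2 ^ 40 :: real)\<^sup>2 \<le> 1 + 2 * s * \<sigma>\<^sup>2" by simp
    then have "2 ^ 40 \<le> sqrt (1 + 2 * s * \<sigma>\<^sup>2)" by (rule real_le_rsqrt)
    then show "1 / sqrt (1 + 2 * s * \<sigma>\<^sup>2) \<le> 1 / 2 ^ 40" by (intro frac_le) auto
    show "0 \<le> 1 / sqrt (1 + 2 * s * \<sigma>\<^sup>2)" using s0 by simp
  qed
  also have "\<dots> = (1 / 32 :: real) ^ (8 * card U)"
    by (simp add: power_mult power_divide)
  also have "\<dots> \<le> (1/32) ^ n"
    using U(2) by (intro power_decreasing) auto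
  also have "exp (s * (\<eta> * real n)) = exp 1 ^ n"
    using s by (simp add: mult.assoc[symmetric] exp_of_nat_mult[symmetric])
  also have "ennreal (exp 1 ^ n) * ennreal ((1/32) ^ n) \<le> ennreal (4 ^ n) * ennreal ((1/32) ^ n)"
    using exp_le by (intro mult_right_mono ennreal_leI power_mono) auto
  also have "\<dots> = ennreal ((1/8) ^ n)"
    by (simp add: ennreal_mult[symmetric] power_mult_distrib[symmetric])
  also note bound = calculation
  show ?thesis
    by (rule bound) (intro mult_left_mono ennreal_leI; simp)+
qed

section \<open>From nets to the spread property\<close>

lemma mv_diff: "mv d X (\<lambda>j. a j - b j) k = mv d X a k - mv d X b k"
  by (simp add: mv_def right_diff_distrib sum_subtractf)

lemma mv_scale: "mv d X (\<lambda>j. t * a j) k = t * mv d X a k"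
  by (simp add: mv_def sum_distrib_left mult_ac)

lemma L2_set_scale: "L2_set (\<lambda>i. t * f i) A = \<bar>t\<bar> * L2_set f A"
  by (simp add: L2_set_def power_mult_distrib real_sqrt_mult flip: sum_distrib_left)

lemma L2_set_le_add_diff: "L2_set f A \<le> L2_set g A + L2_set (\<lambda>i. f i - g i) A"
  using L2_set_triangle_ineq[of g "\<lambda>i. f i - g i" A] by simp

lemma L2_set_mono_set:
  assumes "finite B" "A \<subseteq> B"
  shows "L2_set f A \<le> L2_set f B"
  unfolding L2_set_def using assms by (intro real_sqrt_le_mono sum_mono2) auto

lemma operator_bound_from_half_net:
  assumes net: "\<And>a. L2_set a {..<d} \<le> 1 \<Longrightarrow> \<exists>b\<in>N. L2_set (\<lambda>j. a j - b j) {..<d} \<le> 1/2"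
    and bound: "\<And>b. b \<in> N \<Longrightarrow> L2_set (\<lambda>i. mv d X b (\<gamma> i)) {..<n} \<le> A"
    and a: "L2_set a {..<d} \<le> 1"
  shows "L2_set (\<lambda>i. mv d X a (\<gamma> i)) {..<n} \<le> 2 * A"
proof -
  \<comment> \<open>Applying the net to the rescaled error halves the excess over \<open>2 A\<close> of any a priori bound.\<close>
  define M where "M = (\<Sum>i<n. \<Sum>j<d. \<bar>X (\<gamma> i, j)\<bar>)"
  have iter: "L2_set (\<lambda>i. mv d X a (\<gamma> i)) {..<n} \<le> 2 * A + M * (1/2) ^ k"
    if "L2_set a {..<d} \<le> 1" for k a
    using that
  proof (induction k arbitrary: a)
    case 0
    have aj: "\<bar>a j\<bar> \<le> 1" if "j < d" for j
    proof -
      have "\<bar>a j\<bar> \<le> L2_set (\<lambda>j. \<bar>a j\<bar>) {..<d}" using that by (intro member_le_L2_set) auto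
      also have "\<dots> = L2_set a {..<d}" by (simp add: L2_set_def)
      finally show ?thesis using 0 by linarith
    qed
    have "L2_set (\<lambda>i. mv d X a (\<gamma> i)) {..<n} \<le> (\<Sum>i<n. \<bar>mv d X a (\<gamma> i)\<bar>)"
      by (rule L2_set_le_sum_abs)
    also have "\<dots> \<le> M"
      unfolding mv_def M_def
      using aj by (intro sum_mono order.trans[OF sum_abs]) (auto simp: abs_mult intro!: mult_left_le)
    finally have "L2_set (\<lambda>i. mv d X a (\<gamma> i)) {..<n} \<le> M" .
    \<comment> \<open>The net is nonempty, and any of its points shows that \<open>A\<close> is
      nonnegative.\<close>
    moreover obtain b where "b \<in> N" using net[OF a] by auto
    then have "A \<ge> 0" using bound[of b] L2_set_nonneg order_trans by blast
    ultimately show ?case by simp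
  next
    case (Suc k)
    obtain b where b: "b \<in> N" "L2_set (\<lambda>j. a j - b j) {..<d} \<le> 1/2" using net Suc.prems by blast
    let ?e = "\<lambda>j. 2 * (a j - b j)"
    have "L2_set ?e {..<d} \<le> 1" unfolding L2_set_scale using b by simp
    from Suc.IH[OF this] have "L2_set (\<lambda>i. mv d X ?e (\<gamma> i)) {..<n} \<le> 2 * A + M * (1/2) ^ k" .
    then have "2 * L2_set (\<lambda>i. mv d X a (\<gamma> i) - mv d X b (\<gamma> i)) {..<n} \<le> 2 * A + M * (1/2) ^ k"
      by (simp only: mv_scale mv_diff L2_set_scale)
    then show ?case
      using bound[OF b(1)]
        L2_set_le_add_diff[of "\<lambda>i. mv d X a (\<gamma> i)" "{..<n}" "\<lambda>i. mv d X b (\<gamma> i)"] by simp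
  qed
  \<comment> \<open>The crude constant \<open>M\<close> depends on \<open>X\<close> but disappears
    in the limit.\<close>
  have "(\<lambda>k. 2 * A + M * (1/2) ^ k) \<longlonglongrightarrow> 2 * A + M * 0"
    by (intro tendsto_intros LIMSEQ_power_zero) auto
  then show ?thesis
    using iter[OF a] by (intro LIMSEQ_le_const[of "\<lambda>k. 2 * A + M * (1/2) ^ k"]) auto
qed

text \<open>The deterministic part. The upper bounds on \<open>N1\<close> give \<open>2 * A\<close>
  as operator bound, where \<open>A = sqrt (K * n)\<close>. A unit vector \<open>a\<close> has a
  nearby \<open>b\<close> in \<open>N2\<close>, whose image restricted to \<open>S\<close> has norm
  at least \<open>sqrt (\<eta> * n)\<close>. The condition \<open>16 * K \<le> \<eta> * R\<close>
  limits the error \<open>2 * A / sqrt R\<close> to half of this, and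
  \<open>16 * K * c^2 \<le> \<eta>\<close> puts \<open>c * (2 * A)\<close> below the remaining
  half.\<close>

lemma spread_col_span_resampleI:
  fixes \<eta> c K :: real and R :: nat
  assumes \<gamma>: "\<And>i. i < n \<Longrightarrow> \<gamma> i < n" "n \<le> 4 * card (\<gamma> ` {..<n})"
    and net1: "\<And>a. L2_set a {..<d} \<le> 1 \<Longrightarrow> \<exists>b\<in>N1. L2_set (\<lambda>j. a j - b j) {..<d} \<le> 1/2"
    and upper: "\<And>b. b \<in> N1 \<Longrightarrow> (\<Sum>i<n. (mv d X b (\<gamma> i))\<^sup>2) \<le> K * real n"
    and net2: "\<And>a. L2_set a {..<d} \<le> 1 \<Longrightarrow> \<exists>b\<in>N2. L2_set (\<lambda>j. a j - b j) {..<d} \<le> 1 / sqrt (real R)"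
    and lower: "\<And>b U. b \<in> N2 \<Longrightarrow> L2_set b {..<d} \<ge> 1/2 \<Longrightarrow> U \<subseteq> {..<n} \<Longrightarrow> n \<le> 8 * card U \<Longrightarrow>
        \<eta> * real n \<le> (\<Sum>k\<in>U. (mv d X b k)\<^sup>2)"
    and R: "R \<ge> 4" "16 * K \<le> \<eta> * real R"
    and c: "0 \<le> c" "c \<le> 1/8" "16 * K * c\<^sup>2 \<le> \<eta>"
  shows "spread n (c * real n) c (col_span d (resample X \<gamma>))"
proof -
  let ?Q = "\<lambda>a. L2_set (\<lambda>i. mv d X a (\<gamma> i))"
  define A where "A = sqrt (K * real n)"
  have op: "?Q a {..<n} \<le> 2 * A" if "L2_set a {..<d} \<le> 1" for a
    using net1 _ that
  proof (rule operator_bound_from_half_net)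
    show "?Q b {..<n} \<le> A" if "b \<in> N1" for b
      using upper[OF that] by (simp add: A_def L2_set_def)
  qed
  have R0: "sqrt (real R) \<ge> 2" using R(1) by (intro real_le_rsqrt) simp
  then have R1: "real R > 0" using R(1) by simp
  have unit: "c * ?Q a {..<n} \<le> ?Q a S"
    if S: "S \<subseteq> {..<n}" "real (card S) \<ge> real n - c * real n" and a: "L2_set a {..<d} = 1" for a S
  proof -
    obtain b where b: "b \<in> N2" "L2_set (\<lambda>j. a j - b j) {..<d} \<le> 1 / sqrt (real R)"
      using net2[of a] a by auto
    let ?e = "\<lambda>j. a j - b j"
    have "1 / sqrt (real R) \<le> 1/2" using R0 by (intro frac_le) auto
    then have b_half: "L2_set b {..<d} \<ge> 1/2"
      using L2_set_le_add_diff[of a "{..<d}" b] a b by linarith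
    have fS: "finite S" using S(1) by (rule finite_subset) simp
    \<comment> \<open>One representative index for each value of \<open>\<gamma>\<close> on
      \<open>S\<close>, so that the sum over distinct rows becomes a partial sum over
      \<open>S\<close>.\<close>
    obtain V where V: "V \<subseteq> S" "inj_on \<gamma> V" "\<gamma> ` V = \<gamma> ` S"
      using subset_image_inj[of "\<gamma> ` S" \<gamma> S] by auto
    \<comment> \<open>Deleting at most \<open>n / 8\<close> indices loses at most
      \<open>n / 8\<close> values, and at least \<open>n / 4\<close> were present.\<close>
    have "card (\<gamma> ` {..<n}) \<le> card (\<gamma> ` S \<union> \<gamma> ` ({..<n} - S))"
      by (intro card_mono) (auto simp: fS)
    also have "\<dots> \<le> card (\<gamma> ` S) + card (\<gamma> ` ({..<n} - S))" by (rule card_Un_le)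
    also have "card (\<gamma> ` ({..<n} - S)) \<le> card ({..<n} - S)" by (rule card_image_le) simp
    also have "card ({..<n} - S) = n - card S" using S fS by (simp add: card_Diff_subset)
    finally have "real (card (\<gamma> ` {..<n})) \<le> real (card (\<gamma> ` S)) + (real n - real (card S))"
      using card_mono[OF _ S(1)] by simp
    moreover have "c * real n \<le> 1/8 * real n" using c by (intro mult_right_mono) auto
    moreover have "real n \<le> 4 * real (card (\<gamma> ` {..<n}))" using \<gamma>(2) by linarith
    ultimately have "real n \<le> 8 * real (card (\<gamma> ` S))" using S(2) by argo
    then have cU: "n \<le> 8 * card (\<gamma> ` S)" by linarith
    have "\<eta> * real n \<le> (\<Sum>k\<in>\<gamma> ` S. (mv d X b k)\<^sup>2)"
      using S(1) \<gamma>(1) by (intro lower b b_half cU) auto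
    also have "\<dots> = (\<Sum>i\<in>V. (mv d X b (\<gamma> i))\<^sup>2)"
      unfolding V(3)[symmetric] using V(2) by (simp add: sum.reindex)
    finally have "sqrt (\<eta> * real n) \<le> ?Q b V" by (simp add: L2_set_def)
    also have "\<dots> \<le> ?Q b S" using V(1) fS by (intro L2_set_mono_set) auto
    also have "\<dots> \<le> ?Q a S + ?Q ?e S"
      using L2_set_le_add_diff[of "\<lambda>i. mv d X b (\<gamma> i)" S "\<lambda>i. mv d X a (\<gamma> i)"]
      unfolding mv_diff L2_set_def by (simp add: power2_commute)
    also have "?Q ?e S \<le> ?Q ?e {..<n}" using S(1) by (intro L2_set_mono_set) auto
    also have "\<dots> \<le> 2 * A / sqrt (real R)"
    proof -
      \<comment> \<open>The error vector is scaled up into the unit ball, where \<open>op\<close>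
        applies.\<close>
      have "L2_set (\<lambda>j. sqrt (real R) * ?e j) {..<d} \<le> 1"
        unfolding L2_set_scale
        using mult_left_mono[OF b(2), of "sqrt (real R)"] R(1) by simp
      from op[OF this] have "sqrt (real R) * ?Q ?e {..<n} \<le> 2 * A"
        unfolding mv_scale L2_set_scale by simp
      then show ?thesis using R1 by (simp add: field_simps)
    qed
    also have "2 * A / sqrt (real R) \<le> sqrt (\<eta> * real n) / 2"
    proof -
      have "sqrt (16 * K * real n) \<le> sqrt (\<eta> * real R * real n)"
        using R by (intro real_sqrt_le_mono mult_right_mono) auto
      then have "4 * A \<le> sqrt (\<eta> * real n) * sqrt (real R)"
        by (simp add: A_def real_sqrt_mult mult_ac)
      then show ?thesis using R1 by (simp add: field_simps)
    qed
    finally have "sqrt (\<eta> * real n) / 2 \<le> ?Q a S" by simp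
    moreover have "c * ?Q a {..<n} \<le> sqrt (\<eta> * real n) / 2"
    proof -
      have "c * ?Q a {..<n} \<le> c * (2 * A)" using op[of a] a c by (intro mult_left_mono) auto
      also have "\<dots> = sqrt (16 * K * c\<^sup>2 * real n) / 2"
        using c by (simp add: A_def real_sqrt_mult mult_ac)
      also have "\<dots> \<le> sqrt (\<eta> * real n) / 2"
        using c by (intro divide_right_mono real_sqrt_le_mono mult_right_mono) auto
      finally show ?thesis .
    qed
    ultimately show ?thesis by linarith
  qed
  \<comment> \<open>Both sides are homogeneous in \<open>a\<close>, so the case of unit vectors
    suffices.\<close>
  have all: "c * ?Q a {..<n} \<le> ?Q a S"
    if S: "S \<subseteq> {..<n}" "real (card S) \<ge> real n - c * real n" for a S
  proof (cases "L2_set a {..<d} = 0")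
    case True
    then have "mv d X a k = 0" for k by (simp add: mv_def L2_set_eq_0_iff)
    then show ?thesis by (simp add: L2_set_def)
  next
    case False
    define t where "t = L2_set a {..<d}"
    have t: "t > 0" using False L2_set_nonneg[of a "{..<d}"] unfolding t_def by linarith
    have "L2_set (\<lambda>j. (1 / t) * a j) {..<d} = 1"
      unfolding L2_set_scale t_def[symmetric] using t by simp
    from unit[OF S this] show ?thesis
      unfolding mv_scale L2_set_scale using t by (simp add: field_simps)
  qed
  have eq: "(\<Sum>j<d. resample X \<gamma> i j * a j) = mv d X a (\<gamma> i)" for a i
    by (simp add: resample_def mv_def)
  show ?thesis
    using all unfolding spread_def col_span_def L2_set_def by (auto simp: eq)
qed

section \<open>Resampling indices\<close>

abbreviation uniform_indices :: "nat \<Rightarrow> (nat \<Rightarrow> nat) measure" where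
  "uniform_indices n \<equiv> PiM {..<n} (\<lambda>_. uniform_count_measure {..<n})"

lemma prob_space_uniform_indices: "n > 0 \<Longrightarrow> prob_space (uniform_indices n)"
  by (intro prob_space_PiM prob_space_uniform_count_measure) auto

text \<open>Boxes express both bad index events: \<open>J = {..<n}\<close> says that the image lies
  in \<open>T\<close>, and \<open>T = {k}\<close> says that the fibre over \<open>k\<close> contains
  \<open>J\<close>.\<close>

lemma
  assumes n: "n > 0" and J: "J \<subseteq> {..<n}" and T: "T \<subseteq> {..<n}"
  shows measure_uniform_indices_box:
      "measure (uniform_indices n) {\<gamma> \<in> space (uniform_indices n). \<forall>i\<in>J. \<gamma> i \<in> T} =
        (real (card T) / real n) ^ card J"
    and sets_uniform_indices_box:
      "{\<gamma> \<in> space (uniform_indices n). \<forall>i\<in>J. \<gamma> i \<in> T} \<in> sets (uniform_indices n)"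
proof -
  interpret U: prob_space "uniform_count_measure {..<n}"
    using n by (intro prob_space_uniform_count_measure) auto
  interpret product_prob_space "\<lambda>_. uniform_count_measure {..<n}" "{..<n}" ..
  have fJ: "finite J" using J by (rule finite_subset) simp
  have T': "T \<in> sets (uniform_count_measure {..<n})" using T by (simp add: sets_uniform_count_measure)
  have "emeasure (uniform_indices n) {\<gamma> \<in> space (uniform_indices n). \<forall>i\<in>J. \<gamma> i \<in> T} =
      (\<Prod>i\<in>J. emeasure (uniform_count_measure {..<n}) T)"
    using J fJ T' by (intro emeasure_PiM_Collect) auto
  also have "\<dots> = ennreal ((real (card T) / real n) ^ card J)"
    using T by (simp add: U.emeasure_eq_measure measure_uniform_count_measure ennreal_power)
  finally show "measure (uniform_indices n) {\<gamma> \<in> space (uniform_indices n). \<forall>i\<in>J. \<gamma> i \<in> T} =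
        (real (card T) / real n) ^ card J"
    by (simp add: measure_def)
  have "(\<lambda>\<gamma>. \<gamma> i) -` T \<inter> space (uniform_indices n) \<in> sets (uniform_indices n)" if "i \<in> J" for i
    using that J T' by (intro measurable_sets[OF measurable_component_singleton]) auto
  then have "{\<gamma> \<in> space (uniform_indices n). \<gamma> i \<in> T} \<in> sets (uniform_indices n)" if "i \<in> J" for i
    using that by (simp add: vimage_def Int_def conj_commute)
  then show "{\<gamma> \<in> space (uniform_indices n). \<forall>i\<in>J. \<gamma> i \<in> T} \<in> sets (uniform_indices n)"
    using fJ by (intro sets.sets_Collect_finite_All) auto
qed

text \<open>A fixed set of fewer than \<open>n / 4\<close> values contains the image with
  probability at most \<open>4^-n\<close>, and there are at most \<open>2^n\<close> such
  sets.\<close>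

lemma small_image_event:
  assumes n: "n > 0"
  obtains B where "B \<in> sets (uniform_indices n)" "measure (uniform_indices n) B \<le> (1/2) ^ n"
    "\<And>\<gamma>. \<gamma> \<in> space (uniform_indices n) - B \<Longrightarrow> n \<le> 4 * card (\<gamma> ` {..<n})"
proof -
  let ?P = "uniform_indices n"
  interpret prob_space ?P using n by (rule prob_space_uniform_indices)
  let ?E = "\<lambda>T. {\<gamma> \<in> space ?P. \<forall>i\<in>{..<n}. \<gamma> i \<in> T}"
  define \<T> where "\<T> = {T. T \<subseteq> {..<n} \<and> 4 * card T < n}"
  have \<T>: "finite \<T>" "card \<T> \<le> 2 ^ n"
    using card_mono[of "Pow {..<n}" \<T>] by (auto simp: \<T>_def card_Pow)
  have sets: "?E T \<in> sets ?P" if "T \<in> \<T>" for T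
    using that n by (intro sets_uniform_indices_box) (auto simp: \<T>_def)
  have le: "prob (?E T) \<le> (1/4) ^ n" if T: "T \<in> \<T>" for T
  proof -
    have "prob (?E T) = (real (card T) / real n) ^ card {..<n}"
      using that n by (intro measure_uniform_indices_box) (auto simp: \<T>_def)
    also have "\<dots> \<le> (1/4) ^ n"
      using T n unfolding card_lessThan by (intro power_mono) (auto simp: \<T>_def field_simps)
    finally show ?thesis .
  qed
  have "prob (\<Union>T\<in>\<T>. ?E T) \<le> (\<Sum>T\<in>\<T>. prob (?E T))"
    using \<T> sets by (intro finite_measure_subadditive_finite) auto
  also have "\<dots> \<le> real (card \<T>) * (1/4) ^ n"
    using le by (intro sum_bounded_above)
  also have "\<dots> \<le> 2 ^ n * (1/4) ^ n"
    using \<T>(2) by (intro mult_right_mono) (simp_all flip: of_nat_le_iff)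
  also have "\<dots> = (1/2) ^ n" by (simp add: power_mult_distrib[symmetric])
  finally have "prob (\<Union>T\<in>\<T>. ?E T) \<le> (1/2) ^ n" .
  moreover have "n \<le> 4 * card (\<gamma> ` {..<n})" if "\<gamma> \<in> space ?P - (\<Union>T\<in>\<T>. ?E T)" for \<gamma>
  proof (rule ccontr)
    assume "\<not> n \<le> 4 * card (\<gamma> ` {..<n})"
    moreover have "\<gamma> ` {..<n} \<subseteq> {..<n}"
      using that by (auto simp: space_PiM space_uniform_count_measure)
    ultimately have "\<gamma> ` {..<n} \<in> \<T>" by (simp add: \<T>_def)
    moreover have "\<gamma> \<in> ?E (\<gamma> ` {..<n})" using that by simp
    ultimately show False using that by blast
  qed
  moreover have "(\<Union>T\<in>\<T>. ?E T) \<in> sets ?P" using \<T> sets by auto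
  ultimately show ?thesis using that by blast
qed

text \<open>A fibre with at least \<open>L\<close> elements contains a set \<open>J\<close> of
  exactly \<open>L\<close> indices. The union bound over value and \<open>J\<close> costs
  \<open>n * (n choose L)\<close> against \<open>n^-L\<close>.\<close>

lemma large_fiber_event:
  assumes n: "n > 0"
  obtains B where "B \<in> sets (uniform_indices n)" "measure (uniform_indices n) B \<le> real n / fact L"
    "\<And>\<gamma> k. \<gamma> \<in> space (uniform_indices n) - B \<Longrightarrow> k < n \<Longrightarrow> card {i. i < n \<and> \<gamma> i = k} \<le> L"
proof -
  let ?P = "uniform_indices n"
  interpret prob_space ?P using n by (rule prob_space_uniform_indices)
  let ?E = "\<lambda>(k, J). {\<gamma> \<in> space ?P. \<forall>i\<in>J. \<gamma> i \<in> {k}}"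
  define \<J> where "\<J> = {..<n} \<times> {J. J \<subseteq> {..<n} \<and> card J = L}"
  have \<J>: "finite \<J>" "card \<J> = n * (n choose L)"
    using n_subsets[of "{..<n}" L] by (auto simp: \<J>_def card_cartesian_product)
  have sets: "?E x \<in> sets ?P" if "x \<in> \<J>" for x
    using that n unfolding case_prod_unfold
    by (intro sets_uniform_indices_box) (auto simp: \<J>_def)
  have eq: "prob (?E x) = (1 / real n) ^ L" if "x \<in> \<J>" for x
    using that n measure_uniform_indices_box[of n "snd x" "{fst x}"]
    by (auto simp: \<J>_def)
  have "prob (\<Union>x\<in>\<J>. ?E x) \<le> (\<Sum>x\<in>\<J>. prob (?E x))"
    using \<J> sets by (intro finite_measure_subadditive_finite) auto
  also have "\<dots> = (\<Sum>x\<in>\<J>. (1 / real n) ^ L)"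
    by (intro sum.cong eq refl)
  also have "\<dots> = real n * (real (n choose L) / real n ^ L)"
    by (simp add: \<J> power_divide)
  also have "\<dots> \<le> real n * (1 / fact L)"
  proof (intro mult_left_mono)
    have "real (n choose L) * fact L \<le> real n ^ L"
      using binomial_fact_pow[of n L] by (metis of_nat_fact of_nat_le_iff of_nat_mult of_nat_power)
    then show "real (n choose L) / real n ^ L \<le> 1 / fact L"
      using n by (simp add: field_simps)
  qed simp
  finally have "prob (\<Union>x\<in>\<J>. ?E x) \<le> real n / fact L" by simp
  moreover have "card {i. i < n \<and> \<gamma> i = k} \<le> L"
    if \<gamma>: "\<gamma> \<in> space ?P - (\<Union>x\<in>\<J>. ?E x)" and k: "k < n" for \<gamma> k
  proof (rule ccontr)
    assume "\<not> card {i. i < n \<and> \<gamma> i = k} \<le> L"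
    then have "L \<le> card {i. i < n \<and> \<gamma> i = k}" by simp
    then obtain J where J: "J \<subseteq> {i. i < n \<and> \<gamma> i = k}" "card J = L"
      by (rule obtain_subset_with_card_n)
    then have "(k, J) \<in> \<J>" using k by (auto simp: \<J>_def)
    moreover have "\<gamma> \<in> ?E (k, J)" using \<gamma> J by auto
    ultimately show False using \<gamma> by blast
  qed
  moreover have "(\<Union>x\<in>\<J>. ?E x) \<in> sets ?P" using \<J> sets by auto
  ultimately show ?thesis using that by blast
qed

text \<open>Union bounds for fixed \<open>\<gamma>\<close>. For the upper tail,
  \<open>48^d \<le> exp (4 * d) \<le> exp (8 * n / L)\<close> net points meet
  \<open>exp (- 9 * n / L)\<close>. For the lower tail, at most \<open>4^n\<close> pairs of a net
  point and a row set meet \<open>8^-n\<close>. The constant 608 is \<open>16 * 38\<close>, from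
  \<open>spread_col_span_resampleI\<close> with \<open>K = 38\<close>.\<close>

lemma not_spread_event:
  fixes \<eta> s c :: real and R L :: nat
  assumes \<gamma>: "\<And>i. i < n \<Longrightarrow> \<gamma> i < n" "n \<le> 4 * card (\<gamma> ` {..<n})"
    and L: "L > 0" "\<And>k. k < n \<Longrightarrow> card {i. i < n \<and> \<gamma> i = k} \<le> L" "d * L \<le> 2 * n"
    and s: "s * \<eta> = 1" "s \<ge> 2 ^ 81"
    and R: "R \<ge> 4" "608 \<le> \<eta> * real R" "(R + 2) * d \<le> n"
    and c: "0 \<le> c" "c \<le> 1/8" "608 * c\<^sup>2 \<le> \<eta>"
  obtains B where "B \<in> sets (gaussian_matrix n d)"
    "emeasure (gaussian_matrix n d) B \<le> ennreal (exp (- real n / real L) + (1/2) ^ n)"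
    "\<And>X. X \<in> space (gaussian_matrix n d) - B \<Longrightarrow>
       spread n (c * real n) c (col_span d (resample X \<gamma>))"
proof -
  let ?G = "gaussian_matrix n d"
  obtain N1 :: "(nat \<Rightarrow> real) set" where N1: "finite N1" "real (card N1) \<le> (3 * 2 ^ 4) ^ d"
    "\<And>a. a \<in> N1 \<Longrightarrow> L2_set a {..<d} \<le> 1"
    "\<And>a. L2_set a {..<d} \<le> 1 \<Longrightarrow> \<exists>b\<in>N1. L2_set (\<lambda>j. a j - b j) {..<d} \<le> 1 / sqrt (real 4)"
    by (rule unit_ball_net[of 4 d]) (simp, rule that)
  obtain N2 :: "(nat \<Rightarrow> real) set" where N2: "finite N2" "real (card N2) \<le> (3 * 2 ^ R) ^ d"
    "\<And>a. L2_set a {..<d} \<le> 1 \<Longrightarrow> \<exists>b\<in>N2. L2_set (\<lambda>j. a j - b j) {..<d} \<le> 1 / sqrt (real R)"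
    by (rule unit_ball_net[of R d]) (use R(1) in simp, rule that)
  define B1 where "B1 b = {X \<in> space ?G. (\<Sum>i<n. (mv d X b (\<gamma> i))\<^sup>2) \<ge> 38 * real n}" for b
  define B2 where "B2 = (\<lambda>(b, U). {X \<in> space ?G. (\<Sum>k\<in>U. (mv d X b k)\<^sup>2) \<le> \<eta> * real n})"
  define I2 where "I2 = {b \<in> N2. L2_set b {..<d} \<ge> 1/2} \<times> {U. U \<subseteq> {..<n} \<and> n \<le> 8 * card U}"
  have I2: "finite I2" using N2(1) by (auto simp: I2_def)
  have "card I2 \<le> card (N2 \<times> Pow {..<n})"
    using N2(1) by (intro card_mono) (auto simp: I2_def)
  then have "card I2 \<le> card N2 * 2 ^ n"
    by (simp add: card_cartesian_product card_Pow)
  then have "real (card I2) \<le> real (card N2 * 2 ^ n)" by (simp only: of_nat_le_iff)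
  then have cI2': "real (card I2) \<le> real (card N2) * 2 ^ n" by simp
  have "3 * 2 ^ R \<le> (2 ^ (R + 2) :: real)" by simp
  then have "(3 * 2 ^ R :: real) ^ d \<le> (2 ^ (R + 2)) ^ d" by (rule power_mono) simp
  with N2(2) have "real (card N2) \<le> (2 ^ (R + 2)) ^ d" by (rule order_trans)
  also have "\<dots> = 2 ^ ((R + 2) * d)" by (simp only: power_mult)
  also have "\<dots> \<le> (2 :: real) ^ n" using R(3) by (intro power_increasing) auto
  finally have "real (card N2) * 2 ^ n \<le> 2 ^ n * 2 ^ n" by (intro mult_right_mono) auto
  also have "(2 :: real) ^ n * 2 ^ n = 4 ^ n" by (simp add: power_mult_distrib[symmetric])
  finally have cI2: "real (card I2) \<le> 4 ^ n" by (rule order_trans[OF cI2'])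
  \<comment> \<open>Here \<open>13/8 = 1 + 1/2 + 1/8\<close> is the quadratic Taylor bound for
    \<open>exp (1/2)\<close>.\<close>
  have "(48 :: real) \<le> (13/8) ^ 8" by (simp add: power_divide)
  also have "\<dots> \<le> exp (1/2) ^ 8"
    using exp_lower_Taylor_quadratic[of "1/2"] by (intro power_mono) (auto simp: power2_eq_square)
  also have "\<dots> = exp 4" by (simp add: exp_of_nat_mult[symmetric])
  finally have "(3 * 2 ^ 4 :: real) ^ d \<le> exp 4 ^ d" by (intro power_mono) auto
  also have "\<dots> = exp (4 * real d)" by (simp add: exp_of_nat_mult[symmetric] mult.commute)
  finally have cN1: "real (card N1) \<le> exp (4 * real d)" by (rule order_trans[OF N1(2)])
  have B1_sets: "B1 b \<in> sets ?G" for b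
  proof -
    have "(\<lambda>X. mv d X b (\<gamma> i)) \<in> borel_measurable ?G" if "i < n" for i
      using that \<gamma> by (intro measurable_mv) auto
    then show ?thesis unfolding B1_def by measurable
  qed
  have B2_sets: "B2 x \<in> sets ?G" if "x \<in> I2" for x
  proof -
    have "(\<lambda>X. mv d X (fst x) k) \<in> borel_measurable ?G" if "k \<in> snd x" for k
      using that \<open>x \<in> I2\<close> by (intro measurable_mv) (auto simp: I2_def)
    then show ?thesis unfolding B2_def case_prod_unfold by measurable
  qed
  have E1: "emeasure ?G (\<Union>b\<in>N1. B1 b) \<le> ennreal (exp (- real n / real L))"
  proof -
    have "emeasure ?G (\<Union>b\<in>N1. B1 b) \<le> (\<Sum>b\<in>N1. emeasure ?G (B1 b))"
      using B1_sets N1(1) by (intro emeasure_subadditive_finite) auto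
    also have "\<dots> \<le> (\<Sum>b\<in>N1. ennreal (exp (- 9 * real n / real L)))"
      unfolding B1_def using \<gamma> L N1(3) by (intro sum_mono emeasure_upper_tail) auto
    also have "\<dots> = ennreal (real (card N1) * exp (- 9 * real n / real L))"
      by (simp add: ennreal_mult ennreal_of_nat_eq_real_of_nat)
    also have "real (card N1) * exp (- 9 * real n / real L) \<le>
        exp (4 * real d) * exp (- 9 * real n / real L)"
      using cN1 by (intro mult_right_mono) auto
    also have "\<dots> \<le> exp (- real n / real L)"
    proof -
      have "real d * real L \<le> 2 * real n" using L(3) by (metis of_nat_le_iff of_nat_mult of_nat_numeral)
      then have "4 * real d \<le> 8 * (real n / real L)" using L(1) by (simp add: field_simps)
      then show ?thesis by (simp add: exp_add[symmetric])
    qed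
    finally show ?thesis by (simp add: ennreal_leI)
  qed
  have E2: "emeasure ?G (\<Union>x\<in>I2. B2 x) \<le> ennreal ((1/2) ^ n)"
  proof -
    have "emeasure ?G (\<Union>x\<in>I2. B2 x) \<le> (\<Sum>x\<in>I2. emeasure ?G (B2 x))"
      using B2_sets I2 by (intro emeasure_subadditive_finite) auto
    also have "\<dots> \<le> (\<Sum>x\<in>I2. ennreal ((1/8) ^ n))"
    proof (intro sum_mono)
      fix x assume "x \<in> I2"
      then show "emeasure ?G (B2 x) \<le> ennreal ((1/8) ^ n)"
        unfolding B2_def case_prod_unfold
        by (intro emeasure_lower_tail[OF _ _ s]) (auto simp: I2_def)
    qed
    also have "\<dots> = ennreal (real (card I2) * (1/8) ^ n)"
      by (simp add: ennreal_mult ennreal_of_nat_eq_real_of_nat)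
    also have "real (card I2) * (1/8) ^ n \<le> 4 ^ n * (1/8) ^ n"
      using cI2 by (intro mult_right_mono) auto
    also have "\<dots> = (1/2) ^ n" by (simp add: power_mult_distrib[symmetric])
    finally show ?thesis by (simp add: ennreal_leI)
  qed
  let ?B = "(\<Union>b\<in>N1. B1 b) \<union> (\<Union>x\<in>I2. B2 x)"
  have sets1: "(\<Union>b\<in>N1. B1 b) \<in> sets ?G" using B1_sets N1(1) by auto
  have sets2: "(\<Union>x\<in>I2. B2 x) \<in> sets ?G" using B2_sets I2 by auto
  have "emeasure ?G ?B \<le> emeasure ?G (\<Union>b\<in>N1. B1 b) + emeasure ?G (\<Union>x\<in>I2. B2 x)"
    using sets1 sets2 by (rule emeasure_subadditive)
  also have "\<dots> \<le> ennreal (exp (- real n / real L)) + ennreal ((1/2) ^ n)"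
    using E1 E2 by (rule add_mono)
  finally have "emeasure ?G ?B \<le> ennreal (exp (- real n / real L) + (1/2) ^ n)"
    by (simp add: ennreal_plus)
  moreover have "?B \<in> sets ?G" using sets1 sets2 by auto
  moreover have "spread n (c * real n) c (col_span d (resample X \<gamma>))"
    if X: "X \<in> space ?G - ?B" for X
  proof (rule spread_col_span_resampleI[where K = 38 and \<eta> = \<eta> and R = R and ?N1.0 = N1 and ?N2.0 = N2])
    show "\<exists>b\<in>N1. L2_set (\<lambda>j. a j - b j) {..<d} \<le> 1/2" if "L2_set a {..<d} \<le> 1" for a
      using N1(4)[OF that] by simp
    show "(\<Sum>i<n. (mv d X b (\<gamma> i))\<^sup>2) \<le> 38 * real n" if "b \<in> N1" for b
      using X that by (force simp: B1_def)
    show "\<eta> * real n \<le> (\<Sum>k\<in>U. (mv d X b k)\<^sup>2)"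
      if "b \<in> N2" "L2_set b {..<d} \<ge> 1/2" "U \<subseteq> {..<n}" "n \<le> 8 * card U" for b U
    proof -
      have "(b, U) \<in> I2" using that by (simp add: I2_def)
      then have "X \<notin> B2 (b, U)" using X by blast
      then show ?thesis using X by (simp add: B2_def)
    qed
  qed (use \<gamma> N2 R c in auto)
  ultimately show ?thesis using that by blast
qed

section \<open>Measurability of the spread event\<close>

text \<open>Both sides of the inequality are continuous in the coefficients, so rational ones
  suffice. With extensional functions the family is countable, which makes the event
  measurable.\<close>

lemma spread_col_span_iff_rational:
  "spread n m \<rho> (col_span d A) \<longleftrightarrow>
    (\<forall>a\<in>{..<d} \<rightarrow>\<^sub>E \<rat>. \<forall>S\<in>{S. S \<subseteq> {..<n} \<and> real (card S) \<ge> real n - m}.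
       \<rho> * sqrt (\<Sum>i<n. (\<Sum>j<d. A i j * a j)\<^sup>2) \<le> sqrt (\<Sum>i\<in>S. (\<Sum>j<d. A i j * a j)\<^sup>2))"
  (is "?L \<longleftrightarrow> ?R")
proof
  assume ?L
  then show ?R by (auto simp: spread_def col_span_def)
next
  assume R: ?R
  have "\<rho> * sqrt (\<Sum>i<n. (\<Sum>j<d. A i j * a j)\<^sup>2) \<le> sqrt (\<Sum>i\<in>S. (\<Sum>j<d. A i j * a j)\<^sup>2)"
    if S: "S \<subseteq> {..<n}" "real (card S) \<ge> real n - m" for a S
  proof -
    define q where "q k j = (SOME x. x \<in> \<rat> \<and> \<bar>x - a j\<bar> < 1 / real (Suc k))" for k j
    have "q k j \<in> \<rat> \<and> \<bar>q k j - a j\<bar> < 1 / real (Suc k)" for k j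
      unfolding q_def
    proof (rule someI_ex)
      have "a j < a j + 1 / real (Suc k)" by simp
      from Rats_dense_in_real[OF this]
      show "\<exists>x. x \<in> \<rat> \<and> \<bar>x - a j\<bar> < 1 / real (Suc k)" by force
    qed
    then have q: "q k j \<in> \<rat>" "\<bar>q k j - a j\<bar> < 1 / real (Suc k)" for k j by auto
    have lim: "(\<lambda>k. restrict (q k) {..<d} j) \<longlonglongrightarrow> a j" if "j < d" for j
    proof (rule LIM_zero_cancel, rule LIMSEQ_norm_0)
      show "norm (restrict (q k) {..<d} j - a j) < 1 / real (Suc k)" for k
        using q(2) that by simp
    qed
    have lim': "(\<lambda>k. sqrt (\<Sum>i\<in>I. (\<Sum>j<d. A i j * restrict (q k) {..<d} j)\<^sup>2)) \<longlonglongrightarrow>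
        sqrt (\<Sum>i\<in>I. (\<Sum>j<d. A i j * a j)\<^sup>2)" for I
      by (intro tendsto_intros lim) auto
    have "restrict (q k) {..<d} \<in> {..<d} \<rightarrow>\<^sub>E \<rat>" for k using q(1) by auto
    with R S show ?thesis
      by (intro LIMSEQ_le[OF tendsto_mult_left[OF lim'] lim']) blast
  qed
  then show ?L by (auto simp: spread_def col_span_def)
qed

lemma sets_spread_event:
  "{(X, \<gamma>) \<in> space (sample_space n d). spread n m \<rho> (col_span d (resample X \<gamma>))}
     \<in> sets (sample_space n d)"
proof -
  let ?M = "sample_space n d"
  \<comment> \<open>The row index is itself random; it takes finitely many values, and each fixed
    row gives a measurable entry.\<close>
  have entry [measurable]: "(\<lambda>\<omega>. resample (fst \<omega>) (snd \<omega>) i j) \<in> borel_measurable ?M" if "i < n" "j < d" for i j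
    unfolding resample_def
  proof (rule measurable_compose_countable'[where I = "{..<n}" and f = "\<lambda>k \<omega>. fst \<omega> (k, j)" and g = "\<lambda>\<omega>. snd \<omega> i"])
    show "(\<lambda>\<omega>. fst \<omega> (k, j)) \<in> borel_measurable ?M" if "k \<in> {..<n}" for k
      using that \<open>j < d\<close> unfolding sample_space_def
      by (intro measurable_compose[OF measurable_fst] measurable_entry) auto
    have "(\<lambda>\<omega>. snd \<omega> i) \<in> measurable ?M (uniform_count_measure {..<n})"
      using \<open>i < n\<close> unfolding sample_space_def
      by (intro measurable_compose[OF measurable_snd] measurable_component_singleton) auto
    then show "(\<lambda>\<omega>. snd \<omega> i) \<in> measurable ?M (count_space {..<n})"
      by (subst measurable_cong_sets[of _ ?M _ "uniform_count_measure {..<n}"]) (auto simp: sets_uniform_count_measure)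
  qed auto
  have norm_meas: "(\<lambda>\<omega>. sqrt (\<Sum>i\<in>I. (\<Sum>j<d. resample (fst \<omega>) (snd \<omega>) i j * a j)\<^sup>2)) \<in> borel_measurable ?M"
    if "I \<subseteq> {..<n}" for I a
  proof -
    have "(\<lambda>\<omega>. \<Sum>j<d. resample (fst \<omega>) (snd \<omega>) i j * a j) \<in> borel_measurable ?M" if "i \<in> I" for i
      using that \<open>I \<subseteq> _\<close> by (intro borel_measurable_sum borel_measurable_times entry) auto
    then show ?thesis by measurable
  qed
  have D: "countable ({..<d} \<rightarrow>\<^sub>E (\<rat> :: real set))"
    by (intro countable_PiE countable_rat) auto
  let ?S = "{S. S \<subseteq> {..<n} \<and> real (card S) \<ge> real n - m}"
  have "{\<omega> \<in> space ?M. \<forall>a\<in>{..<d} \<rightarrow>\<^sub>E \<rat>. \<forall>S\<in>?S.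
      \<rho> * sqrt (\<Sum>i<n. (\<Sum>j<d. resample (fst \<omega>) (snd \<omega>) i j * a j)\<^sup>2) \<le>
      sqrt (\<Sum>i\<in>S. (\<Sum>j<d. resample (fst \<omega>) (snd \<omega>) i j * a j)\<^sup>2)} \<in> sets ?M"
    using D norm_meas
    by (intro sets.sets_Collect_countable_All' borel_measurable_le borel_measurable_times)
       (auto intro: countable_finite)
  then show ?thesis
    by (simp add: spread_col_span_iff_rational case_prod_unfold)
qed

text \<open>Since \<open>exp 1 \<le> 3\<close>, it suffices to bound \<open>3^L / fact L\<close>,
  which is largest at \<open>L = 2\<close> and \<open>L = 3\<close>, with value 9/2. For
  \<open>L \<ge> 2 * ln n\<close> this turns \<open>n / fact L\<close> into at most
  \<open>5 / n\<close>.\<close>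

lemma exp_nat_le_fact: "exp (real L) \<le> 5 * fact L"
proof -
  have "(3::real) ^ L \<le> 5 * fact L"
  proof (induction L)
    case (Suc L)
    show ?case
    proof (cases "L \<le> 1")
      case True
      then show ?thesis by (auto simp: le_Suc_eq)
    next
      case False
      have "(3::real) * 3 ^ L \<le> real (Suc L) * (5 * fact L)"
        using False Suc by (intro mult_mono) auto
      then show ?thesis by simp
    qed
  qed simp
  moreover have "exp (real L) \<le> 3 ^ L"
    using power_mono[OF exp_le, of L] by (simp add: exp_of_nat_mult[symmetric])
  ultimately show ?thesis by linarith
qed

section \<open>Assembling the estimates\<close>

text \<open>Fubini over \<open>\<gamma>\<close>: the section of the failure event has measure at
  most 1 when \<open>\<gamma>\<close> lies in \<open>B1\<close> or \<open>B2\<close>, and at most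
  \<open>\<delta>\<close> otherwise. One term \<open>(1/2)^n\<close> comes from \<open>B1\<close>,
  the other from \<open>\<delta>\<close>.\<close>

lemma measure_spread_ge:
  fixes \<eta> s c :: real and R L :: nat
  assumes n: "n > 0" and L: "L > 0" "d * L \<le> 2 * n"
    and s: "s * \<eta> = 1" "s \<ge> 2 ^ 81"
    and R: "R \<ge> 4" "608 \<le> \<eta> * real R" "(R + 2) * d \<le> n"
    and c: "0 \<le> c" "c \<le> 1/8" "608 * c\<^sup>2 \<le> \<eta>"
  shows "measure (sample_space n d)
      {(X, \<gamma>) \<in> space (sample_space n d). spread n (c * real n) c (col_span d (resample X \<gamma>))}
    \<ge> 1 - (real n / fact L + 2 * (1/2) ^ n + exp (- real n / real L))"
proof -
  let ?G = "gaussian_matrix n d" and ?P = "uniform_indices n" and ?M = "sample_space n d"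
  let ?E = "{(X, \<gamma>) \<in> space ?M. spread n (c * real n) c (col_span d (resample X \<gamma>))}"
  define \<delta> where "\<delta> = exp (- real n / real L) + (1/2) ^ n"
  have \<delta>: "\<delta> \<ge> 0" by (simp add: \<delta>_def)
  interpret G: prob_space ?G by (rule prob_space_gaussian_matrix)
  interpret P: prob_space ?P using n by (rule prob_space_uniform_indices)
  interpret GP: pair_prob_space ?G ?P ..
  have M: "?M = ?G \<Otimes>\<^sub>M ?P" by (simp add: sample_space_def)
  interpret M: prob_space ?M unfolding M by (rule GP.prob_space_axioms)
  obtain B1 where B1: "B1 \<in> sets ?P" "measure ?P B1 \<le> (1/2) ^ n"
    "\<And>\<gamma>. \<gamma> \<in> space ?P - B1 \<Longrightarrow> n \<le> 4 * card (\<gamma> ` {..<n})"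
    using small_image_event[OF n] by blast
  obtain B2 where B2: "B2 \<in> sets ?P" "measure ?P B2 \<le> real n / fact L"
    "\<And>\<gamma> k. \<gamma> \<in> space ?P - B2 \<Longrightarrow> k < n \<Longrightarrow> card {i. i < n \<and> \<gamma> i = k} \<le> L"
    using large_fiber_event[OF n, where L = L] by blast
  have E: "?E \<in> sets ?M" by (rule sets_spread_event)
  have B: "B1 \<union> B2 \<in> sets ?P" using B1(1) B2(1) by auto
  have section_le: "emeasure ?G ((\<lambda>X. (X, \<gamma>)) -` (space ?M - ?E)) \<le> indicator (B1 \<union> B2) \<gamma> + ennreal \<delta>"
    if \<gamma>: "\<gamma> \<in> space ?P" for \<gamma>
  proof (cases "\<gamma> \<in> B1 \<union> B2")
    case True
    have "emeasure ?G ((\<lambda>X. (X, \<gamma>)) -` (space ?M - ?E)) \<le> 1"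
      by (rule G.emeasure_le_1)
    also have "1 \<le> 1 + ennreal \<delta>" by simp
    finally show ?thesis using True by simp
  next
    case False
    have \<gamma>n: "\<gamma> i < n" if "i < n" for i
      using \<gamma> that by (auto simp: space_PiM space_uniform_count_measure)
    have image: "n \<le> 4 * card (\<gamma> ` {..<n})" using \<gamma> False by (intro B1(3)) auto
    have fibers: "card {i. i < n \<and> \<gamma> i = k} \<le> L" if "k < n" for k
      using \<gamma> False that by (intro B2(3)) auto
    obtain B where B: "B \<in> sets ?G" "emeasure ?G B \<le> ennreal \<delta>"
      "\<And>X. X \<in> space ?G - B \<Longrightarrow> spread n (c * real n) c (col_span d (resample X \<gamma>))"
      by (rule not_spread_event[OF \<gamma>n image L(1) fibers L(2) s R c, folded \<delta>_def])
         (assumption | rule that)+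
    have "(\<lambda>X. (X, \<gamma>)) -` (space ?M - ?E) \<subseteq> B"
      using B(3) by (auto simp: M space_pair_measure)
    then have "emeasure ?G ((\<lambda>X. (X, \<gamma>)) -` (space ?M - ?E)) \<le> emeasure ?G B"
      using B(1) by (rule emeasure_mono)
    with B(2) False show ?thesis by simp
  qed
  have "emeasure ?M (space ?M - ?E) = (\<integral>\<^sup>+\<gamma>. emeasure ?G ((\<lambda>X. (X, \<gamma>)) -` (space ?M - ?E)) \<partial>?P)"
    using E unfolding M by (intro GP.emeasure_pair_measure_alt2) auto
  also have "\<dots> \<le> (\<integral>\<^sup>+\<gamma>. indicator (B1 \<union> B2) \<gamma> + ennreal \<delta> \<partial>?P)"
    by (intro nn_integral_mono section_le)
  also have "\<dots> = emeasure ?P (B1 \<union> B2) + ennreal \<delta>"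
    using B by (subst nn_integral_add) (auto simp: P.emeasure_space_1)
  also have "\<dots> = ennreal (measure ?P (B1 \<union> B2) + \<delta>)"
    using \<delta> by (simp add: P.emeasure_eq_measure)
  finally have "measure ?M (space ?M - ?E) \<le> measure ?P (B1 \<union> B2) + \<delta>"
    unfolding M.emeasure_eq_measure using \<delta> by (subst (asm) ennreal_le_iff) auto
  moreover have "measure ?P (B1 \<union> B2) \<le> measure ?P B1 + measure ?P B2"
    using B1(1) B2(1) by (rule measure_Un_le)
  ultimately show ?thesis
    using M.prob_compl[OF E] B1(2) B2(2) by (simp add: \<delta>_def)
qed

section \<open>Logarithm estimates and the choice of constants\<close>

lemma ln_le_sqrt:
  fixes x :: real
  assumes "x > 0"
  shows "ln x \<le> sqrt x"
proof -
  have "ln x = 2 * ln (sqrt x)" using assms by (simp add: ln_sqrt)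
  also have "\<dots> = 2 * ln (sqrt x / 2) + 2 * ln 2" using assms by (simp add: ln_div)
  also have "\<dots> \<le> 2 * (sqrt x / 2 - 1) + 2 * 1"
    using assms ln_le_minus_one[of "sqrt x / 2"] ln_le_minus_one[of "2::real"]
    by (intro add_mono mult_left_mono) auto
  finally show ?thesis by simp
qed

text \<open>Trades \<open>ln (2 * d)\<close> for \<open>ln n\<close>, since \<open>L\<close> grows
  with \<open>ln n\<close>. If \<open>2 * d\<close> is at most \<open>sqrt n\<close>, then
  \<open>ln n \<le> sqrt n\<close> suffices; otherwise
  \<open>ln n \<le> 2 * ln (2 * d)\<close>.\<close>

lemma dim_ln_le:
  fixes n d :: nat
  assumes n: "n > 0" and nd: "real n \<ge> 4 * real d * ln (2 * real d)"
  shows "2 * real d * ln (real n) \<le> real n"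
proof (cases "2 * real d \<le> sqrt (real n)")
  case True
  have "2 * real d * ln (real n) \<le> sqrt (real n) * sqrt (real n)"
    using n True by (intro mult_mono ln_le_sqrt) auto
  then show ?thesis by simp
next
  case False
  then have "sqrt (real n) \<le> 2 * real d" by simp
  moreover have "0 < sqrt (real n)" using n by simp
  ultimately have "ln (sqrt (real n)) \<le> ln (2 * real d)" by (intro ln_mono)
  then have "ln (real n) \<le> 2 * ln (2 * real d)" using n by (simp add: ln_sqrt)
  then have "2 * real d * ln (real n) \<le> 2 * real d * (2 * ln (2 * real d))"
    by (intro mult_left_mono) auto
  then show ?thesis using nd by simp
qed

theorem mainTheorem16:
  shows "\<exists>C > 0. \<exists>c > 0. \<exists>p :: nat \<Rightarrow> real.
     (\<forall>n. 0 \<le> p n \<and> p n \<le> 1) \<and> p \<longlonglongrightarrow> 0 \<and>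
     (\<forall>n d :: nat. real n \<ge> C * real d * ln (2 * real d) \<longrightarrow>
        measure (sample_space n d)
          {(X, \<gamma>) \<in> space (sample_space n d).
             spread n (c * real n) c (col_span d (resample X \<gamma>))}
        \<ge> 1 - p n)"
proof -
  \<comment> \<open>\<open>R\<close> is kept opaque, since \<open>unit_ball_net\<close> produces the number \<open>2\<^sup>R\<close>.\<close>
  obtain s \<eta> :: real and R :: nat where s: "s * \<eta> = 1" "s \<ge> 2 ^ 81" "0 < \<eta>" "\<eta> \<le> 1"
    and R: "R \<ge> 4" "608 \<le> \<eta> * real R"
  proof
    \<comment> \<open>The exponent 91 leaves \<open>\<eta> * R = 2^10 = 1024\<close>, above
      608.\<close>
    show "(2 ^ 81 :: real) * (1 / 2 ^ 81) = 1" "608 \<le> (1 / 2 ^ 81 :: real) * real (2 ^ 91)" by simp_all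
  qed simp_all
  define c where "c = sqrt (\<eta> / 608)"
  have "sqrt (\<eta> / 608) \<le> sqrt ((1/8)\<^sup>2)"
    using s by (intro real_sqrt_le_mono) (simp add: power2_eq_square)
  then have c: "c > 0" "c \<le> 1/8" "608 * c\<^sup>2 \<le> \<eta>"
    using s by (simp_all add: c_def)
  \<comment> \<open>For \<open>d > 0\<close>, \<open>ln (2 * d) \<ge> 1/2\<close>, so this
    \<open>C\<close> forces \<open>(R + 2) * d \<le> n\<close>.\<close>
  define C where "C = 2 * real (R + 2)"
  define p where "p n = min 1 (5 / real n + 2 * (1/2) ^ n + exp (- sqrt (real n) / 4))" for n :: nat
  have C: "C \<ge> 4" by (simp add: C_def)
  have "(\<lambda>n. 5 / real n + 2 * (1/2) ^ n + exp (- sqrt (real n) / 4)) \<longlonglongrightarrow> 0"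
    by real_asymp
  from tendsto_min[OF tendsto_const[of "1::real"] this] have p_lim: "p \<longlonglongrightarrow> 0"
    by (simp add: p_def[abs_def])
  have main: "measure (sample_space n d)
          {(X, \<gamma>) \<in> space (sample_space n d).
             spread n (c * real n) c (col_span d (resample X \<gamma>))} \<ge> 1 - p n"
    if nd: "real n \<ge> C * real d * ln (2 * real d)" for n d :: nat
  proof (cases "n \<ge> 2")
    case False
    then consider "n = 0" | "n = 1" by linarith
    \<comment> \<open>At \<open>n = 0\<close> the term \<open>5 / real n\<close> is 0 by convention,
      but \<open>2 * (1/2)^0 = 2\<close> already exceeds 1.\<close>
    then have "p n = 1" by cases (simp_all add: p_def)
    then show ?thesis by simp
  next
    case True
    define l where "l = ln (real n)"
    \<comment> \<open>Large enough for \<open>exp L \<ge> n^2\<close>, small enough for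
      \<open>L \<le> 4 * ln n\<close>, which yields both \<open>d * L \<le> 2 * n\<close> and
      \<open>n / L \<ge> sqrt n / 4\<close>.\<close>
    define L where "L = nat \<lceil>2 * l\<rceil>"
    have "2/3 \<le> ln (2::real)" by (rule ln2_ge_two_thirds)
    also have "ln 2 \<le> l" using True by (simp add: l_def)
    finally have l: "2/3 \<le> l" .
    then have L: "2 * l \<le> real L" "real L \<le> 2 * l + 1" unfolding L_def by linarith+
    have L0: "L > 0" using L l by (cases L) auto
    have ln2d: "ln (2 * real d) \<ge> 1/2" if "d > 0"
    proof -
      have "ln 2 \<le> ln (2 * real d)" using that by simp
      then show ?thesis using ln2_ge_two_thirds by linarith
    qed
    have "4 * real d * ln (2 * real d) \<le> C * real d * ln (2 * real d)"
      using C ln2d by (cases "d = 0") (auto intro!: mult_right_mono)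
    then have dl: "2 * real d * l \<le> real n"
      unfolding l_def using nd True by (intro dim_ln_le) auto
    have "real d * real L \<le> real d * (4 * l)"
      using L l by (intro mult_left_mono) auto
    with dl have "real (d * L) \<le> real (2 * n)" by simp
    then have dL: "d * L \<le> 2 * n" by (simp only: of_nat_le_iff)
    have "real ((R + 2) * d) \<le> C * real d * ln (2 * real d)"
    proof (cases "d = 0")
      case False
      have "real ((R + 2) * d) = C * real d * (1/2)" by (simp add: C_def algebra_simps)
      also have "\<dots> \<le> C * real d * ln (2 * real d)"
        using C ln2d False by (intro mult_left_mono) auto
      finally show ?thesis .
    qed simp
    with nd have Rd: "(R + 2) * d \<le> n" by linarith
    have "1 - (real n / fact L + 2 * (1/2) ^ n + exp (- real n / real L)) \<le> measure (sample_space n d)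
          {(X, \<gamma>) \<in> space (sample_space n d).
             spread n (c * real n) c (col_span d (resample X \<gamma>))}"
      using True c by (intro measure_spread_ge[OF _ L0 dL s(1,2) R Rd]) auto
    moreover have "real n / fact L \<le> 5 / real n"
    proof -
      have "real n * real n = exp (2 * l)"
        using True by (simp add: l_def exp_double power2_eq_square)
      also have "\<dots> \<le> exp (real L)" using L by simp
      also have "\<dots> \<le> 5 * fact L" by (rule exp_nat_le_fact)
      finally show ?thesis using True by (simp add: field_simps)
    qed
    moreover have "exp (- real n / real L) \<le> exp (- sqrt (real n) / 4)"
    proof -
      have "real L \<le> 4 * sqrt (real n)"
        using L l ln_le_sqrt[of "real n"] True by (simp add: l_def)
      then have "sqrt (real n) * real L \<le> sqrt (real n) * (4 * sqrt (real n))"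
        by (intro mult_left_mono) auto
      also have "\<dots> = 4 * real n" by (simp add: mult.left_commute[of _ 4])
      finally have "sqrt (real n) / 4 \<le> real n / real L"
        using L0 by (simp add: field_simps)
      then show ?thesis by simp
    qed
    moreover have "0 \<le> measure (sample_space n d)
          {(X, \<gamma>) \<in> space (sample_space n d).
             spread n (c * real n) c (col_span d (resample X \<gamma>))}" by simp
    ultimately show ?thesis unfolding p_def by linarith
  qed
  show ?thesis
  proof (intro exI conjI allI impI)
    show "0 < C" "0 < c" using C c by auto
    show "0 \<le> p n" "p n \<le> 1" for n by (simp_all add: p_def)
  qed (fact p_lim main)+
qed

end
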